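(* Let $c>5/2$ and let $p_{lk}=n^{-c}$ for all nodes in the Bayesian CART prior. Suppose $f_0$ satisfies Assumption (F)(a) or Assumption (F)(b) (stated in the context), with the constant $A>0$ (independent of $n$) sufficiently large. Then, with probability at least $1-4/n$, $$\Pi(\mathcal T^*\mid Y)\;\ge\; 1-\frac{1}{n^{c-5/2}-1}-\frac{1}{n^{(A^2/8)\log n}}.$$
   Context: Model: $n=2^{L_{\max}+1}$, $x_i=i/n$, and $Y_i=f_0(x_i)+\varepsilon_i$ for $i=1,\dots,n$ with $\varepsilon_i$ i.i.d. $\mathcal N(0,1)$; probability refers to the law of $Y=(Y_1,\dots,Y_n)'$. Haar basis: $\psi_{-10}=I_{[0,1]}$ and $\psi_{lk}(x)=2^{l/2}\psi(2^lx-k)$ for $l\ge 0$, $0\le k<2^l$, with $\psi=I_{(0,1/2]}-I_{(1/2,1]}$. $\bm X$ is the $n\times p$ matrix, $p=2^{L_{\max}}=n/2$, whose columns are $(\psi_{lk}(x_i))_{i\le n}$ for $(l,k)=(-1,0)$ and $0\le l<L_{\max}$, $0\le k<2^l$ (so $\bm X'\bm X=nI_p$). Trees: fix $L\le L_{\max}$. A tree $\mathcal T$ of depth at most $L$ is determined by its set of internal nodes $\mathcal T_{int}$, consisting of $(-1,0)$ together with a (possibly empty) set of nodes $(l,k)$, $0\le l<L$, $0\le k<2^l$, that contains with each $(l,k)$, $l\ge1$, its parent $(l-1,\lfloor k/2\rfloor)$. The children of $(l,k)$ ($l\ge 0$) are $(l+1,2k),(l+1,2k+1)$; the only child of $(-1,0)$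 is $(0,0)$. The external nodes $\mathcal T_{ext}$ are the nodes not in $\mathcal T_{int}$ that are children of nodes in $\mathcal T_{int}$ (so $|\mathcal T_{ext}|=|\mathcal T_{int}|$). $\mathbb T_L$ is the set of all such trees. Bayesian CART prior and posterior: $\Pi(\mathcal T)\propto\prod_{(l,k)\in\mathcal T_{int}}p_{lk}\prod_{(l,k)\in\mathcal T_{ext}}(1-p_{lk})$ on $\mathbb T_L$; given $\mathcal T$, the coefficients $\beta_{lk}$, $(l,k)\in\mathcal T_{int}$, are i.i.d. $\mathcal N(0,1)$ and all others are $0$; the likelihood is $Y\mid\beta\sim\mathcal N(\bm X\beta,I_n)$. Equivalently $\Pi(\mathcal T\mid Y)\propto\Pi(\mathcal T)N_Y(\mathcal T)$ with $$N_Y(\mathcal T)=\frac{\exp\{-\frac12Y'[I-\bm X_{\mathcal T}\Sigma_{\mathcal T}\bm X_{\mathcal T}']Y\}}{(2\pi)^{n/2}(1+n)^{|\mathcal T_{ext}|/2}},\qquad \Sigma_{\mathcal T}=\tfrac{n}{n+1}(\bm X_{\mathcal T}'\bm X_{\mathcal T})^{-1},$$ where $\bm X_{\mathcal T}$ consists of the columns of $\bm X$ indexed by $\mathcal T_{int}$. Assumption (F): $f_0=\sum_{(l,k)\in\mathcal B}\beta^*_{lk}\psi_{lk}$ for some $\mathcal B\subseteq\{(l,k):l<L\}$ with $A\log n/\sqrt n<|\beta^*_{lk}|<C_{f_0}$ for all $(l,k)\in\mathcal B$, for constants $A>0$, $C_{f_0}>0$. $\mathcal T^*\in\mathbb T_L$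 denotes the smallest tree with $\mathcal B\subseteq\mathcal T^*_{int}$. (a): $\mathcal B$ is itself the internal node set of a tree, i.e. $\mathcal T^*_{int}=\mathcal B$. (b): $\mathcal B$ is not the internal node set of a tree in $\mathbb T_L$. *)

theory Defs
  imports "HOL-Probability.Probability"
begin

text \<open>A node is a pair \<open>(l, k)\<close>; the level \<open>l\<close> is an integer because the coarsest node is \<open>(-1, 0)\<close>.\<close>

type_synonym node = "int \<times> nat"

definition nodes :: "nat \<Rightarrow> node set" where
  "nodes L = insert (-1, 0) {(l, k). 0 \<le> l \<and> l < int L \<and> k < 2 ^ nat l}"

definition haar_mother :: "real \<Rightarrow> real" where
  "haar_mother x = indicator {0<..1/2} x - indicator {1/2<..1} x"

definition haar :: "node \<Rightarrow> real \<Rightarrow> real" where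
  "haar = (\<lambda>(l, k) x.
     if l = -1 then indicator {0..1} x
     else 2 powr (real_of_int l / 2) * haar_mother (2 powr real_of_int l * x - real k))"

definition sample_size :: "nat \<Rightarrow> nat" where
  "sample_size Lmax = 2 ^ (Lmax + 1)"

definition design_point :: "nat \<Rightarrow> nat \<Rightarrow> real" where
  "design_point n i = real i / real n"

text \<open>The law of \<open>Y = (Y\<^sub>1, \<dots>, Y\<^sub>n)\<close> for \<open>Y\<^sub>i = f0 (x\<^sub>i) + \<epsilon>\<^sub>i\<close>, where the noise vector has the product law
  of \<open>n\<close> standard normal distributions.\<close>

definition data_law :: "nat \<Rightarrow> (real \<Rightarrow> real) \<Rightarrow> (nat \<Rightarrow> real) measure" where
  "data_law n f0 =
     distr (Pi\<^sub>M {1..n} (\<lambda>_. density lborel std_normal_density)) (Pi\<^sub>M {1..n} (\<lambda>_. borel))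
       (\<lambda>eps. \<lambda>i\<in>{1..n}. f0 (design_point n i) + eps i)"

definition design_matrix :: "nat \<Rightarrow> nat \<Rightarrow> node \<Rightarrow> real" where
  "design_matrix Lmax i v = haar v (design_point (sample_size Lmax) i)"

text \<open>Density at \<open>y\<close> of the normal law with mean \<open>X \<beta>\<close> and identity covariance.\<close>

definition likelihood :: "nat \<Rightarrow> (node \<Rightarrow> real) \<Rightarrow> (nat \<Rightarrow> real) \<Rightarrow> real" where
  "likelihood Lmax \<beta> y =
     (\<Prod>i\<in>{1..sample_size Lmax}.
        normal_density (\<Sum>v\<in>nodes Lmax. design_matrix Lmax i v * \<beta> v) 1 (y i))"

text \<open>A tree is identified with its set of internal nodes.\<close>

type_synonym tree = "node set"

definition trees :: "nat \<Rightarrow> tree set" where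
  "trees L = {T. T \<subseteq> nodes L \<and> (-1, 0) \<in> T \<and>
                 (\<forall>(l, k)\<in>T. l \<ge> 1 \<longrightarrow> (l - 1, k div 2) \<in> T)}"

definition children :: "node \<Rightarrow> node set" where
  "children = (\<lambda>(l, k). if l = -1 then {(0, 0)} else {(l + 1, 2 * k), (l + 1, 2 * k + 1)})"

definition external :: "tree \<Rightarrow> node set" where
  "external T = (\<Union>v\<in>T. children v) - T"

text \<open>\<open>LEAST\<close> refers to inclusion of the sets of internal nodes.\<close>

definition smallest_tree :: "nat \<Rightarrow> node set \<Rightarrow> tree" where
  "smallest_tree L B = (LEAST T. T \<in> trees L \<and> B \<subseteq> T)"

lemma smallest_tree:
  assumes "B \<subseteq> nodes L"
  shows "smallest_tree L B \<in> trees L" "B \<subseteq> smallest_tree L B"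
    and "\<And>T. T \<in> trees L \<Longrightarrow> B \<subseteq> T \<Longrightarrow> smallest_tree L B \<subseteq> T"
proof -
  define S where "S = {T. T \<in> trees L \<and> B \<subseteq> T}"
  have full: "nodes L \<in> S"
  proof -
    have "k div 2 < 2 ^ nat (l - 1)" if "1 \<le> l" "k < 2 ^ nat l" for l :: int and k :: nat
    proof -
      have "nat l = Suc (nat (l - 1))" using that(1) by simp
      then show ?thesis using that(2) by (metis less_mult_imp_div_less mult.commute power_Suc)
    qed
    then show ?thesis using assms by (auto simp: S_def trees_def nodes_def)
  qed
  have inter: "\<Inter>S \<in> trees L"
    unfolding trees_def mem_Collect_eq
  proof (intro conjI)
    show "\<Inter>S \<subseteq> nodes L" using full by blast
    show "(-1, 0) \<in> \<Inter>S" by (simp add: S_def trees_def)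
    show "\<forall>(l, k)\<in>\<Inter>S. l \<ge> 1 \<longrightarrow> (l - 1, k div 2) \<in> \<Inter>S"
    proof (clarify)
      fix l k T
      assume a: "(l, k) \<in> \<Inter>S" and l: "l \<ge> 1" and T: "T \<in> S"
      have "(l, k) \<in> T" using a T by blast
      then show "(l - 1, k div 2) \<in> T" using T l unfolding S_def trees_def by blast
    qed
  qed
  have sub: "B \<subseteq> \<Inter>S" unfolding S_def by blast
  have eq: "smallest_tree L B = \<Inter>S"
    unfolding smallest_tree_def
  proof (rule Least_equality)
    show "\<Inter>S \<in> trees L \<and> B \<subseteq> \<Inter>S" using inter sub by (rule conjI)
    show "\<Inter>S \<subseteq> T" if "T \<in> trees L \<and> B \<subseteq> T" for T using that unfolding S_def by blast
  qed
  show "smallest_tree L B \<in> trees L" unfolding eq by (rule inter)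
  show "B \<subseteq> smallest_tree L B" unfolding eq by (rule sub)
  show "smallest_tree L B \<subseteq> T" if "T \<in> trees L" "B \<subseteq> T" for T unfolding eq S_def using that by blast
qed

definition tree_weight :: "(node \<Rightarrow> real) \<Rightarrow> tree \<Rightarrow> real" where
  "tree_weight p T = (\<Prod>v\<in>T. p v) * (\<Prod>v\<in>external T. 1 - p v)"

definition tree_prior :: "nat \<Rightarrow> (node \<Rightarrow> real) \<Rightarrow> tree \<Rightarrow> real" where
  "tree_prior L p T = tree_weight p T / (\<Sum>S\<in>trees L. tree_weight p S)"

definition coeff_prior :: "tree \<Rightarrow> (node \<Rightarrow> real) measure" where
  "coeff_prior T = Pi\<^sub>M T (\<lambda>_. density lborel std_normal_density)"

text \<open>Points of \<open>coeff_prior T\<close> are \<open>undefined\<close> outside \<open>T\<close>, so the coefficients of the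
  remaining nodes are set to \<open>0\<close> explicitly.\<close>

definition marginal_likelihood :: "nat \<Rightarrow> (nat \<Rightarrow> real) \<Rightarrow> tree \<Rightarrow> real" where
  "marginal_likelihood Lmax y T =
     (\<integral>b. likelihood Lmax (\<lambda>v. if v \<in> T then b v else 0) y \<partial>coeff_prior T)"

definition tree_posterior ::
    "nat \<Rightarrow> nat \<Rightarrow> (node \<Rightarrow> real) \<Rightarrow> (nat \<Rightarrow> real) \<Rightarrow> tree \<Rightarrow> real" where
  "tree_posterior Lmax L p y T =
     tree_prior L p T * marginal_likelihood Lmax y T /
       (\<Sum>S\<in>trees L. tree_prior L p S * marginal_likelihood Lmax y S)"

definition assumption_F ::
    "nat \<Rightarrow> nat \<Rightarrow> real \<Rightarrow> real \<Rightarrow> node set \<Rightarrow> (node \<Rightarrow> real) \<Rightarrow> (real \<Rightarrow> real) \<Rightarrow> bool" where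
  "assumption_F n L A C B \<beta> f0 \<longleftrightarrow>
     B \<subseteq> nodes L \<and>
     (\<forall>x\<in>{0..1}. f0 x = (\<Sum>v\<in>B. \<beta> v * haar v x)) \<and>
     (\<forall>v\<in>B. A * ln (real n) / sqrt (real n) < \<bar>\<beta> v\<bar> \<and> \<bar>\<beta> v\<bar> < C)"

definition assumption_Fa ::
    "nat \<Rightarrow> nat \<Rightarrow> real \<Rightarrow> real \<Rightarrow> node set \<Rightarrow> (node \<Rightarrow> real) \<Rightarrow> (real \<Rightarrow> real) \<Rightarrow> bool" where
  "assumption_Fa n L A C B \<beta> f0 \<longleftrightarrow> assumption_F n L A C B \<beta> f0 \<and> B \<in> trees L"

definition assumption_Fb ::
    "nat \<Rightarrow> nat \<Rightarrow> real \<Rightarrow> real \<Rightarrow> node set \<Rightarrow> (node \<Rightarrow> real) \<Rightarrow> (real \<Rightarrow> real) \<Rightarrow> bool" where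
  "assumption_Fb n L A C B \<beta> f0 \<longleftrightarrow> assumption_F n L A C B \<beta> f0 \<and> B \<notin> trees L"

end

theory Submission
  imports Defs
begin

text \<open>
  The design matrix is orthogonal, \<open>X' X = n I\<close>, so the likelihood, as a function of the coefficients,
  is a product over the nodes, and so is the Gaussian prior; the coefficients can be integrated
  out one at a time. The tree prior is a product as well: a tree has as many
  external as internal nodes, hence each internal node contributes \<open>p (1 - p)\<close>. Altogether
  \<open>\<Pi>(T | Y)\<close> is proportional to \<open>\<Prod>v\<in>T. w v\<close> (\<open>tree_posterior_eq\<close>), where
  \<open>w v = p * (1 - p) * exp ((g v)\<^sup>2 / (2 * (n + 1))) / sqrt (n + 1)\<close>
  and \<open>g v = X\<^sub>v' Y\<close> is the score of the node. The score equals \<open>n \<beta>\<^sub>v\<close> plus noise of variance \<open>n\<close>, and by a Chernoff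
  bound all noise terms are below \<open>2 \<surd>(n ln n)\<close> simultaneously, with probability at least \<open>1 - 4/n\<close>
  (\<open>noise_bounded\<close>). The rest of the argument is deterministic on this event.

  A node outside \<open>\<B>\<close> carries weight at most \<open>n powr (3/2 - c)\<close>, because a noise term gains at most the factor
  \<open>n\<^sup>2\<close> in the exponential and the prior and the dimension penalty cost \<open>n powr (- c - 1/2)\<close>. There are at most \<open>n / 2\<close>
  nodes, so adding spurious nodes to the true tree costs in total a factor \<open>exp (n powr (5/2 - c) / 2)\<close>.

  Omitting a node of \<open>\<B>\<close> multiplies the weight by at most \<open>n powr (c + 2) * exp (- A\<^sup>2/4 * (ln n)\<^sup>2)\<close>. The
  smallest tree also contains ancestors without signal, and omitting one of those may increase the weight,
  but by no more than \<open>n powr (c + 2)\<close>. A tree is closed under parents, so every omitted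
  ancestor lies below the root on the path to some omitted node of \<open>\<B>\<close>: there are at most
  \<open>L \<le> 3/2 * ln n\<close> omitted nodes per omitted signal (\<open>card_missing_le\<close>). The total gain is therefore
  of the order \<open>exp (const * (ln n)\<^sup>2)\<close> per omitted signal, and for \<open>A\<close> large in terms of \<open>c\<close> the
  signal outweighs it, with enough room to sum over all sets of omitted nodes. The two effects, a set of
  added nodes and a set of omitted nodes, are summed independently in \<open>posterior_mass_ge\<close>.
\<close>

section \<open>Combinatorics of trees\<close>

lemma finite_nodes: "finite (nodes L)"
proof -
  have "nodes L \<subseteq> {-1..int L} \<times> {..2 ^ L}"
  proof
    fix v assume "v \<in> nodes L"
    then consider "v = (-1, 0)" | l k where "v = (l, k)" "0 \<le> l" "l < int L" "k < 2 ^ nat l"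
      by (auto simp: nodes_def)
    then show "v \<in> {-1..int L} \<times> {..2 ^ L}"
    proof cases
      case 2
      have "(2::nat) ^ nat l \<le> 2 ^ L" using 2 by (intro power_increasing) auto
      then have "k \<le> 2 ^ L" using 2(4) by linarith
      then show ?thesis using 2 by auto
    qed auto
  qed
  then show ?thesis by (rule finite_subset) auto
qed

lemma nodes_mono: "L \<le> M \<Longrightarrow> nodes L \<subseteq> nodes M"
  by (auto simp: nodes_def)

lemma finite_trees: "finite (trees L)"
  by (rule finite_subset[of _ "Pow (nodes L)"]) (auto simp: trees_def finite_nodes)

lemma card_nodes: "card (nodes L) \<le> 2 ^ L"
proof (induction L)
  case 0
  have "nodes 0 = {(-1, 0)}" by (auto simp: nodes_def)
  then show ?case by simp
next
  case (Suc L)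
  have "nodes (Suc L) \<subseteq> nodes L \<union> Pair (int L) ` {..<2 ^ L}"
  proof
    fix v assume "v \<in> nodes (Suc L)"
    moreover obtain l k where "v = (l, k)" by fastforce
    ultimately show "v \<in> nodes L \<union> Pair (int L) ` {..<2 ^ L}"
      by (cases "l = int L") (auto simp: nodes_def)
  qed
  then have "card (nodes (Suc L)) \<le> card (nodes L \<union> Pair (int L) ` {..<2 ^ L})"
    by (intro card_mono) (auto simp: finite_nodes)
  also have "\<dots> \<le> card (nodes L) + card (Pair (int L) ` {..<(2::nat) ^ L})"
    by (rule card_Un_le)
  also have "card (Pair (int L) ` {..<(2::nat) ^ L}) = 2 ^ L"
    by (subst card_image) (auto simp: inj_on_def)
  finally show ?case using Suc by simp
qed

text \<open>No node is the child of two nodes. A tree with \<open>m\<close> internal nodes thus has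
\<open>2 (m - 1) + 1\<close> children in total, the root having a single one, and all internal nodes except the root are among them.\<close>

lemma card_external:
  assumes T: "T \<in> trees L"
  shows "card (external T) = card T"
proof -
  let ?r = "(-1, 0) :: node"
  have fin: "finite T" using T finite_nodes finite_subset by (auto simp: trees_def)
  have lev: "0 \<le> l" if "(l, k) \<in> T" "(l, k) \<noteq> ?r" for l k
    using that T by (auto simp: trees_def nodes_def)
  have root: "?r \<in> T" using T by (auto simp: trees_def)
  have fc: "finite (children v)" for v by (auto simp: children_def split: prod.splits)
  have disj: "children v \<inter> children w = {}" if "v \<in> T" "w \<in> T" "v \<noteq> w" for v w
  proof -
    obtain l k l' k' where vw: "v = (l, k)" "w = (l', k')" by fastforce
    have "l = -1 \<longrightarrow> k = 0" "l' = -1 \<longrightarrow> k' = 0" "-1 \<le> l" "-1 \<le> l'"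
      using that T by (auto simp: vw trees_def nodes_def)
    then show ?thesis using that(3) unfolding vw children_def
      by auto
  qed
  have "card (\<Union>v\<in>T. children v) = (\<Sum>v\<in>T. card (children v))"
    using fin fc disj by (intro card_UN_disjoint) auto
  also have "\<dots> = card (children ?r) + (\<Sum>v\<in>T - {?r}. card (children v))"
    by (rule sum.remove[OF fin root])
  also have "(\<Sum>v\<in>T - {?r}. card (children v)) = (\<Sum>v\<in>T - {?r}. 2)"
    by (rule sum.cong) (auto simp: children_def dest: lev)
  finally have all: "card (\<Union>v\<in>T. children v) = 1 + 2 * card (T - {?r})"
    by (simp add: children_def)
  \<comment> \<open>Being a child of an internal node is automatic for internal nodes other than the root.\<close>
  have inter: "T \<inter> (\<Union>v\<in>T. children v) = T - {?r}"
  proof (intro equalityI subsetI)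
    fix v assume v: "v \<in> T \<inter> (\<Union>v\<in>T. children v)"
    then obtain l k where "(l, k) \<in> T" "v \<in> children (l, k)" by auto
    moreover have "-1 \<le> l" using calculation(1) T by (auto simp: trees_def nodes_def)
    ultimately show "v \<in> T - {?r}" using v by (auto simp: children_def split: if_splits)
  next
    fix v assume v: "v \<in> T - {?r}"
    then obtain l k where lk: "v = (l, k)" "0 \<le> l" using lev by (cases v) auto
    show "v \<in> T \<inter> (\<Union>v\<in>T. children v)"
    proof (cases "l = 0")
      case True
      then have "v \<in> children ?r" using v T lk by (auto simp: children_def trees_def nodes_def)
      then show ?thesis using v root by blast
    next
      case False
      then have "(l - 1, k div 2) \<in> T" using v T lk by (auto simp: trees_def)
      moreover have "v \<in> children (l - 1, k div 2)"
        using lk False by (auto simp: children_def)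
      ultimately show ?thesis using v by blast
    qed
  qed
  have "card (external T) = card (\<Union>v\<in>T. children v) - card (T - {?r})"
    unfolding external_def inter[symmetric]
    by (subst card_Diff_subset_Int) (auto simp: fin Int_commute)
  also have "\<dots> = Suc (card (T - {?r}))" using all by simp
  also have "\<dots> = card T" using card_Suc_Diff1[OF fin root] by simp
  finally show ?thesis .
qed

text \<open>The node itself is included; at the root of the tree, level \<open>-1\<close>, the truncation \<open>nat l = 0\<close> makes this
a singleton. The chain stops at level \<open>0\<close>, because the root belongs to every tree anyway.\<close>

definition ancestors :: "node \<Rightarrow> node set" where
  "ancestors = (\<lambda>(l, k). (\<lambda>j. (l - int j, k div 2 ^ j)) ` {..nat l})"

text \<open>Adding to \<open>T\<close> the ancestors of the elements of \<open>B\<close> it lacks gives a tree that contains \<open>B\<close>, so the smallest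
such tree has nothing else outside \<open>T\<close>. A node of level \<open>l < L\<close> has \<open>l + 1 \<le> L\<close> ancestors, itself included.\<close>

lemma card_missing_le:
  assumes T: "T \<in> trees L" and B: "B \<subseteq> nodes L"
  shows "card (smallest_tree L B - T) \<le> L * card (B - T)"
proof -
  let ?G = "T \<union> (\<Union>v\<in>B - T. ancestors v)"
  have fin: "finite (B - T)" using finite_subset[OF B finite_nodes] by auto
  have new: "0 \<le> l \<and> l < int L \<and> k < 2 ^ nat l" if "(l, k) \<in> B - T" for l k
    using that B T by (auto simp: trees_def nodes_def)
  have "?G \<in> trees L"
    unfolding trees_def mem_Collect_eq
  proof (intro conjI)
    have "(l - int j, k div 2 ^ j) \<in> nodes L" if "(l, k) \<in> B - T" "j \<le> nat l" for l k j
    proof -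
      have "nat l = j + nat (l - int j)" using that(2) new[OF that(1)] by auto
      then have "(2::nat) ^ nat l = 2 ^ nat (l - int j) * 2 ^ j"
        by (metis mult.commute power_add)
      then have "k div 2 ^ j < 2 ^ nat (l - int j)"
        using new[OF that(1)] by (metis less_mult_imp_div_less)
      then show ?thesis using that(2) new[OF that(1)] by (auto simp: nodes_def)
    qed
    then show "?G \<subseteq> nodes L" using T by (auto simp: ancestors_def trees_def)
    show "(-1, 0) \<in> ?G" using T by (auto simp: trees_def)
    show "\<forall>(l, k)\<in>?G. l \<ge> 1 \<longrightarrow> (l - 1, k div 2) \<in> ?G"
    proof (clarify)
      fix l k
      assume lk: "(l, k) \<in> ?G" "l \<ge> 1" and no: "(l - 1, k div 2) \<notin> (\<Union>v\<in>B - T. ancestors v)"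
      have "(l, k) \<in> T"
      proof (rule ccontr)
        assume "(l, k) \<notin> T"
        then obtain l' k' j where *: "(l', k') \<in> B - T" "j \<le> nat l'" "l = l' - int j" "k = k' div 2 ^ j"
          using lk(1) by (fastforce simp: ancestors_def)
        have "(l - 1, k div 2) = (l' - int (Suc j), k' div 2 ^ Suc j)" "Suc j \<le> nat l'"
          using * lk(2) by (auto simp: div_mult2_eq[symmetric] mult.commute)
        then have "(l - 1, k div 2) \<in> ancestors (l', k')"
          unfolding ancestors_def prod.case by (intro image_eqI[of _ _ "Suc j"]) simp_all
        then show False using no *(1) by blast
      qed
      then show "(l - 1, k div 2) \<in> T" using T lk(2) by (auto simp: trees_def)
    qed
  qed
  moreover have "B \<subseteq> ?G"
  proof
    fix v assume "v \<in> B"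
    moreover have "v \<in> ancestors v"
      by (auto simp: ancestors_def image_iff split: prod.splits intro!: bexI[of _ 0])
    ultimately show "v \<in> ?G" by blast
  qed
  ultimately have "smallest_tree L B - T \<subseteq> (\<Union>v\<in>B - T. ancestors v)"
    using smallest_tree(3)[OF B] by blast
  moreover have "finite (\<Union>v\<in>B - T. ancestors v)"
    using fin by (auto simp: ancestors_def)
  ultimately have "card (smallest_tree L B - T) \<le> card (\<Union>v\<in>B - T. ancestors v)"
    by (rule card_mono[rotated])
  also have "\<dots> \<le> (\<Sum>v\<in>B - T. card (ancestors v))" by (rule card_UN_le[OF fin])
  also have "\<dots> \<le> (\<Sum>v\<in>B - T. L)"
  proof (rule sum_mono)
    fix v assume v: "v \<in> B - T"
    obtain l k where lk: "v = (l, k)" by fastforce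
    have "card (ancestors v) \<le> card {..nat l}"
      unfolding lk ancestors_def prod.case by (rule card_image_le) simp
    then show "card (ancestors v) \<le> L" using new[OF v[unfolded lk]] by auto
  qed
  finally show ?thesis by (simp add: mult.commute)
qed

section \<open>Orthogonality of the Haar columns\<close>

text \<open>The sign pattern of a Haar function along the design, where \<open>h\<close> is half the length of its support and
\<open>j\<close> is the sample index counted from zero.\<close>

definition haar_sign :: "nat \<Rightarrow> nat \<Rightarrow> nat \<Rightarrow> real" where
  "haar_sign h k j = of_bool (j div h = 2 * k) - of_bool (j div h = 2 * k + 1)"

text \<open>The support intervals are half-open on the left, so the index \<open>i = j + 1\<close>, rather than \<open>j\<close>, falls into
the block \<open>(q h, (q + 1) h]\<close> precisely when \<open>j div h = q\<close>.\<close>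

lemma haar_at_design_point:
  assumes M: "l \<le> M"
  shows "haar (int l, k) (design_point (2 * 2 ^ M) (Suc j)) =
    2 powr (real l / 2) * haar_sign (2 ^ (M - l)) k j"
proof -
  define h :: nat where "h = 2 ^ (M - l)"
  have h: "0 < h" by (simp add: h_def)
  have pow: "(2::nat) * 2 ^ M = 2 ^ l * (2 * h)"
    unfolding h_def using M by (simp flip: power_add)
  have x: "2 powr real_of_int (int l) * design_point (2 * 2 ^ M) (Suc j) - real k
      = real (Suc j) / (2 * real h) - real k" (is "?x = _")
    using arg_cong[OF pow, of real] h
    by (simp add: design_point_def powr_realpow field_simps)
  have block: "real q * real h < real (Suc j) \<and> real (Suc j) \<le> real (q + 1) * real h
      \<longleftrightarrow> j div h = q" for q
  proof -
    have "real q * real h < real (Suc j) \<and> real (Suc j) \<le> real (q + 1) * real h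
      \<longleftrightarrow> q * h < Suc j \<and> Suc j \<le> (q + 1) * h"
      by (simp only: of_nat_mult[symmetric] of_nat_le_iff of_nat_less_iff)
    also have "\<dots> \<longleftrightarrow> j div h = q"
      using h by (auto simp: less_Suc_eq_le Suc_le_eq div_nat_eqI div_times_less_eq_dividend mult.commute
          dividend_less_times_div)
    finally show ?thesis .
  qed
  have left: "?x \<in> {0<..1/2} \<longleftrightarrow> j div h = 2 * k"
    unfolding x block[symmetric] using h by (auto simp: field_simps)
  have right: "?x \<in> {1/2<..1} \<longleftrightarrow> j div h = 2 * k + 1"
    unfolding x block[symmetric] using h by (auto simp: field_simps)
  show ?thesis
    unfolding haar_def haar_mother_def indicator_def prod.case left right haar_sign_def h_def[symmetric]
    by simp
qed

lemma card_div_eq: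
  fixes h q N :: nat
  assumes "0 < h" "(q + 1) * h \<le> N"
  shows "card {j. j < N \<and> j div h = q} = h"
proof -
  have "{j. j < N \<and> j div h = q} = {q * h..<q * h + h}"
  proof (intro equalityI subsetI)
    fix j assume "j \<in> {j. j < N \<and> j div h = q}"
    then show "j \<in> {q * h..<q * h + h}"
      using assms dividend_less_times_div[of h j] by (auto simp: mult.commute)
  next
    fix j assume "j \<in> {q * h..<q * h + h}"
    then show "j \<in> {j. j < N \<and> j div h = q}"
      using assms by (auto intro: div_nat_eqI simp: mult.commute)
  qed
  then show ?thesis by simp
qed

lemma
  fixes h k N :: nat
  assumes h: "0 < h" and kN: "(2 * k + 2) * h \<le> N"
  shows sum_haar_sign: "(\<Sum>j<N. haar_sign h k j) = 0"
    and sum_haar_sign_sq: "(\<Sum>j<N. (haar_sign h k j)\<^sup>2) = 2 * real h"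
proof -
  have le: "(2 * k + 1) * h \<le> N"
    by (rule le_trans[OF _ kN]) simp
  have half: "(\<Sum>j<N. of_bool (j div h = q) :: real) = real h" if "(q + 1) * h \<le> N" for q
  proof -
    have "(\<Sum>j<N. of_bool (j div h = q) :: real) = (\<Sum>j\<in>{j. j < N \<and> j div h = q}. 1)"
      by (rule sum.mono_neutral_cong_right) auto
    then show ?thesis using card_div_eq[OF h that] by simp
  qed
  have halves: "(\<Sum>j<N. of_bool (j div h = 2 * k) :: real) = real h"
    "(\<Sum>j<N. of_bool (j div h = 2 * k + 1) :: real) = real h"
    using half[of "2 * k"] half[of "2 * k + 1"] le kN by (auto simp: algebra_simps)
  then show "(\<Sum>j<N. haar_sign h k j) = 0"
    by (simp add: haar_sign_def sum_subtractf)
  have "(haar_sign h k j)\<^sup>2 = of_bool (j div h = 2 * k) + of_bool (j div h = 2 * k + 1)" for j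
    by (simp add: haar_sign_def)
  then show "(\<Sum>j<N. (haar_sign h k j)\<^sup>2) = 2 * real h"
    using halves by (simp add: sum.distrib)
qed

text \<open>Dyadic blocks are nested: a Haar function is constant on the support of every finer one. Its product with the finer one
is a multiple of the latter, which sums to zero.\<close>

lemma haar_sign_coarse_fine:
  assumes h': "0 < h'" and d: "h = 2 * h' * d"
  shows "haar_sign h k j * haar_sign h' k' j = haar_sign h k (2 * h' * k') * haar_sign h' k' j"
proof (cases "haar_sign h' k' j = 0")
  case False
  then have "j div h' = 2 * k' \<or> j div h' = 2 * k' + 1" by (auto simp: haar_sign_def)
  then have "j div h' div 2 = k'" by auto
  then have "j div (2 * h') = 2 * h' * k' div (2 * h')"
    using h' by (simp add: div_mult2_eq[symmetric] mult.commute)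
  then have "j div h = 2 * h' * k' div h" unfolding d by (metis div_mult2_eq)
  then show ?thesis by (simp add: haar_sign_def)
qed simp

lemma haar_sign_same_level:
  assumes "k \<noteq> k'"
  shows "haar_sign h k j * haar_sign h k' j = 0"
  using assms by (auto simp: haar_sign_def)

lemma sum_over_design:
  "(\<Sum>i\<in>{1..sample_size M}. g (design_point (sample_size M) i)) =
   (\<Sum>j<2 * 2 ^ M. g (design_point (2 * 2 ^ M) (Suc j)))"
  by (simp add: sample_size_def sum.atLeast1_atMost_eq)

lemma haar_root: "i \<in> {1..n} \<Longrightarrow> haar (-1, k) (design_point n i) = 1"
  by (auto simp: haar_def design_point_def indicator_def)

lemma block_fits:
  assumes "l < M" "k < 2 ^ l"
  shows "(2 * k + 2) * 2 ^ (M - l) \<le> (2::nat) * 2 ^ M"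
proof -
  have "(2 * k + 2) * 2 ^ (M - l) \<le> (2 * 2 ^ l) * (2::nat) ^ (M - l)"
    using assms(2) by (intro mult_right_mono) auto
  also have "\<dots> = 2 * 2 ^ M" using assms(1) by (simp flip: power_add)
  finally show ?thesis .
qed

lemma design_orthogonal_levels:
  assumes v: "(l, k) \<in> nodes M" and w: "(l', k') \<in> nodes M" and lt: "l < l'"
  shows "(\<Sum>i\<in>{1..sample_size M}. design_matrix M i (l, k) * design_matrix M i (l', k')) = 0"
proof -
  obtain b where b: "l' = int b" "b < M" "k' < 2 ^ b"
    using v w lt by (cases l') (auto simp: nodes_def)
  have sum0: "(\<Sum>i\<in>{1..sample_size M}. design_matrix M i (l', k')) = 0"
    using sum_haar_sign[OF _ block_fits[OF b(2,3)]] b(2)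
    unfolding design_matrix_def b(1) sum_over_design[of "haar (int b, k')"]
    by (simp add: haar_at_design_point flip: sum_distrib_left)
  show ?thesis
  proof (cases "l = -1")
    case True
    then show ?thesis using sum0 by (simp add: design_matrix_def haar_root)
  next
    case False
    then obtain a where a: "l = int a" using v by (cases l) (auto simp: nodes_def)
    have ab: "a < b" using a b lt by simp
    have "M - a = Suc (M - b) + (b - 1 - a)" using ab b by simp
    then have d: "(2::nat) ^ (M - a) = 2 * 2 ^ (M - b) * 2 ^ (b - 1 - a)"
      by (metis power_Suc power_add)
    let ?c = "2 powr (real a / 2) * haar_sign (2 ^ (M - a)) k (2 * 2 ^ (M - b) * k')"
    have "(\<Sum>i\<in>{1..sample_size M}. design_matrix M i (l, k) * design_matrix M i (l', k'))
      = (\<Sum>i\<in>{1..sample_size M}. ?c * design_matrix M i (l', k'))"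
      unfolding design_matrix_def sum_over_design[of "\<lambda>x. haar (l, k) x * haar (l', k') x"]
        sum_over_design[of "\<lambda>x. ?c * haar (l', k') x"]
    proof (rule sum.cong)
      fix j
      show "haar (l, k) (design_point (2 * 2 ^ M) (Suc j)) * haar (l', k') (design_point (2 * 2 ^ M) (Suc j))
        = ?c * haar (l', k') (design_point (2 * 2 ^ M) (Suc j))"
        using haar_sign_coarse_fine[OF _ d, of k j k'] ab b(2)
        by (simp add: a b(1) haar_at_design_point)
    qed simp
    then show ?thesis using sum0 by (simp flip: sum_distrib_left)
  qed
qed

text \<open>This is \<open>X' X = n I\<close>.\<close>

lemma design_orthogonal:
  assumes v: "v \<in> nodes M" and w: "w \<in> nodes M"
  shows "(\<Sum>i\<in>{1..sample_size M}. design_matrix M i v * design_matrix M i w) =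
    (if v = w then real (sample_size M) else 0)"
proof -
  obtain l k l' k' where vw: "v = (l, k)" "w = (l', k')" by fastforce
  consider "l < l'" | "l' < l" | "l = -1" "l' = -1" | a where "l = int a" "l' = int a"
    using v w by (cases l; cases l') (fastforce simp: vw nodes_def)+
  then show ?thesis
  proof cases
    case 1
    then show ?thesis using design_orthogonal_levels v w vw by auto
  next
    case 2
    then show ?thesis using design_orthogonal_levels[of l' k' M l k] v w vw by (auto simp: mult.commute)
  next
    case 3
    then have "k = 0" "k' = 0" using v w by (auto simp: vw nodes_def)
    then show ?thesis using 3 by (simp add: vw design_matrix_def haar_root)
  next
    case (4 a)
    have a: "a < M" "k < 2 ^ a" using v 4 by (auto simp: vw nodes_def)
    have sc: "2 powr (real a / 2) * 2 powr (real a / 2) = (2 ^ a :: real)"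
      by (simp flip: powr_add add: powr_realpow)
    have "(\<Sum>i\<in>{1..sample_size M}. design_matrix M i v * design_matrix M i w) =
      (\<Sum>j<2 * 2 ^ M. 2 ^ a * (haar_sign (2 ^ (M - a)) k j * haar_sign (2 ^ (M - a)) k' j))"
      unfolding design_matrix_def vw 4 sum_over_design[of "\<lambda>x. haar (int a, k) x * haar (int a, k') x"]
      using a by (simp add: haar_at_design_point mult_ac flip: sc)
    also have "\<dots> = (if v = w then real (sample_size M) else 0)"
    proof (cases "k = k'")
      case True
      have "(2::real) ^ a * (2 * 2 ^ (M - a)) = 2 * 2 ^ M"
        using a by (simp flip: power_add)
      then show ?thesis using sum_haar_sign_sq[OF _ block_fits[OF a]] True
        by (simp add: vw 4 sample_size_def sum_distrib_left[symmetric] power2_eq_square)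
    next
      case False
      then show ?thesis by (simp add: vw haar_sign_same_level)
    qed
    finally show ?thesis .
  qed
qed

section \<open>The posterior as a product over nodes\<close>

abbreviation std_normal :: "real measure" where
  "std_normal \<equiv> density lborel std_normal_density"

lemma prob_space_std_normal: "prob_space std_normal"
  by (rule prob_space_normal_density) simp

lemma product_sigma_finite_std_normal: "product_sigma_finite (\<lambda>_. std_normal)"
  using prob_space_imp_sigma_finite[OF prob_space_std_normal] by (simp add: product_sigma_finite_def)

text \<open>Completing the square: an exponential tilt of a normal density is again a multiple of a normal density. The case \<open>a = n\<close> integrates out
a coefficient, the case \<open>a = 0\<close> is the moment generating function.\<close>

lemma normal_tilt:
  assumes a: "0 \<le> a"
  shows "std_normal_density b * exp (b * g - a * b\<^sup>2 / 2) =
    exp (g\<^sup>2 / (2 * (a + 1))) / sqrt (a + 1) * normal_density (g / (a + 1)) (1 / sqrt (a + 1)) b"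
proof -
  have s: "(1 / sqrt (a + 1))\<^sup>2 = 1 / (a + 1)" using a by (simp add: power_divide)
  have e: "- b\<^sup>2 / 2 + (b * g - a * b\<^sup>2 / 2) =
      g\<^sup>2 / (2 * (a + 1)) + - (b - g / (a + 1))\<^sup>2 / (2 * (1 / (a + 1)))"
  proof -
    define r where "r = g / (a + 1)"
    have "g = r * (a + 1)" using a by (simp add: r_def)
    then show ?thesis
      using a unfolding r_def[symmetric] by (simp add: field_simps power2_eq_square)
  qed
  have n: "1 / sqrt (2 * pi * (1 / (a + 1))) = sqrt (a + 1) / sqrt (2 * pi)"
    using a by (simp add: real_sqrt_divide real_sqrt_mult)
  have "std_normal_density b * exp (b * g - a * b\<^sup>2 / 2) =
      1 / sqrt (2 * pi) * exp (- b\<^sup>2 / 2 + (b * g - a * b\<^sup>2 / 2))"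
    unfolding std_normal_density_def exp_add by simp
  also have "\<dots> = 1 / sqrt (2 * pi) *
      (exp (g\<^sup>2 / (2 * (a + 1))) * exp (- (b - g / (a + 1))\<^sup>2 / (2 * (1 / (a + 1)))))"
    unfolding e exp_add ..
  also have "\<dots> = exp (g\<^sup>2 / (2 * (a + 1))) / sqrt (a + 1) * normal_density (g / (a + 1)) (1 / sqrt (a + 1)) b"
    unfolding normal_density_def s n using a by simp
  finally show ?thesis .
qed

lemma
  assumes a: "0 \<le> a"
  shows integrable_normal_exp: "integrable std_normal (\<lambda>b. exp (b * g - a * b\<^sup>2 / 2))"
    and integral_normal_exp:
      "(\<integral>b. exp (b * g - a * b\<^sup>2 / 2) \<partial>std_normal) = exp (g\<^sup>2 / (2 * (a + 1))) / sqrt (a + 1)"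
proof -
  have "1 / sqrt (a + 1) > 0" using a by simp
  then show "integrable std_normal (\<lambda>b. exp (b * g - a * b\<^sup>2 / 2))"
    and "(\<integral>b. exp (b * g - a * b\<^sup>2 / 2) \<partial>std_normal) = exp (g\<^sup>2 / (2 * (a + 1))) / sqrt (a + 1)"
    by (simp_all add: integrable_density integral_density normal_tilt[OF a])
qed

definition score :: "nat \<Rightarrow> (nat \<Rightarrow> real) \<Rightarrow> node \<Rightarrow> real" where
  "score M y v = (\<Sum>i\<in>{1..sample_size M}. design_matrix M i v * y i)"

text \<open>Orthogonality removes the mixed terms from the square of \<open>X \<beta>\<close>.\<close>

lemma likelihood_eq:
  "likelihood M \<beta> y = (\<Prod>i\<in>{1..sample_size M}. std_normal_density (y i)) *
     (\<Prod>v\<in>nodes M. exp (\<beta> v * score M y v - real (sample_size M) * (\<beta> v)\<^sup>2 / 2))"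
proof -
  let ?I = "{1..sample_size M}" and ?N = "nodes M" and ?X = "design_matrix M"
  define m where "m i = (\<Sum>v\<in>?N. ?X i v * \<beta> v)" for i
  have nd: "normal_density u 1 x = std_normal_density x * exp (u * x - u\<^sup>2 / 2)" for u x :: real
  proof -
    have "- (x - u)\<^sup>2 / 2 = - x\<^sup>2 / 2 + (u * x - u\<^sup>2 / 2)" by (simp add: power2_eq_square field_simps)
    then have "exp (- (x - u)\<^sup>2 / 2) = exp (- x\<^sup>2 / 2) * exp (u * x - u\<^sup>2 / 2)"
      by (metis exp_add)
    then show ?thesis by (simp add: normal_density_def)
  qed
  have cross: "(\<Sum>i\<in>?I. m i * y i) = (\<Sum>v\<in>?N. \<beta> v * score M y v)"
    unfolding m_def score_def sum_distrib_left sum_distrib_right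
    by (subst sum.swap) (simp add: mult_ac)
  have "(\<Sum>i\<in>?I. (m i)\<^sup>2) = (\<Sum>i\<in>?I. \<Sum>v\<in>?N. \<Sum>w\<in>?N. \<beta> v * \<beta> w * (?X i v * ?X i w))"
    unfolding m_def power2_eq_square sum_product by (intro sum.cong refl) (simp add: mult_ac)
  also have "\<dots> = (\<Sum>v\<in>?N. \<Sum>i\<in>?I. \<Sum>w\<in>?N. \<beta> v * \<beta> w * (?X i v * ?X i w))"
    by (rule sum.swap)
  also have "\<dots> = (\<Sum>v\<in>?N. \<Sum>w\<in>?N. \<beta> v * \<beta> w * (\<Sum>i\<in>?I. ?X i v * ?X i w))"
    unfolding sum_distrib_left by (intro sum.cong refl sum.swap)
  also have "\<dots> = (\<Sum>v\<in>?N. \<Sum>w\<in>?N. if v = w then real (sample_size M) * (\<beta> v)\<^sup>2 else 0)"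
    by (intro sum.cong refl) (subst design_orthogonal, simp_all add: power2_eq_square)
  also have "\<dots> = (\<Sum>v\<in>?N. real (sample_size M) * (\<beta> v)\<^sup>2)"
    by (simp add: finite_nodes)
  finally have sq: "(\<Sum>i\<in>?I. (m i)\<^sup>2) = (\<Sum>v\<in>?N. real (sample_size M) * (\<beta> v)\<^sup>2)" .
  have "likelihood M \<beta> y = (\<Prod>i\<in>?I. std_normal_density (y i) * exp (m i * y i - (m i)\<^sup>2 / 2))"
    unfolding likelihood_def m_def[symmetric] by (intro prod.cong refl nd)
  also have "\<dots> = (\<Prod>i\<in>?I. std_normal_density (y i)) * exp (\<Sum>i\<in>?I. m i * y i - (m i)\<^sup>2 / 2)"
    by (simp add: prod.distrib exp_sum)
  also have "(\<Sum>i\<in>?I. m i * y i - (m i)\<^sup>2 / 2) =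
      (\<Sum>v\<in>?N. \<beta> v * score M y v - real (sample_size M) * (\<beta> v)\<^sup>2 / 2)"
    unfolding sum_subtractf cross sum_divide_distrib[symmetric] sq ..
  finally show ?thesis by (simp add: exp_sum finite_nodes)
qed

lemma marginal_likelihood_eq:
  assumes T: "T \<subseteq> nodes M"
  shows "marginal_likelihood M y T = (\<Prod>i\<in>{1..sample_size M}. std_normal_density (y i)) *
    (\<Prod>v\<in>T. exp ((score M y v)\<^sup>2 / (2 * (real (sample_size M) + 1))) / sqrt (real (sample_size M) + 1))"
proof -
  let ?n = "real (sample_size M)" and ?D = "\<Prod>i\<in>{1..sample_size M}. std_normal_density (y i)"
  have fin: "finite T" using T finite_nodes finite_subset by auto
  have "likelihood M (\<lambda>v. if v \<in> T then b v else 0) y =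
      ?D * (\<Prod>v\<in>T. exp (b v * score M y v - ?n * (b v)\<^sup>2 / 2))" for b
    unfolding likelihood_eq using T
    by (intro arg_cong[where f = "(*) ?D"] prod.mono_neutral_cong_right) (auto simp: finite_nodes)
  then have "marginal_likelihood M y T =
      ?D * (\<integral>b. (\<Prod>v\<in>T. exp (b v * score M y v - ?n * (b v)\<^sup>2 / 2)) \<partial>coeff_prior T)"
    by (simp add: marginal_likelihood_def)
  also have "(\<integral>b. (\<Prod>v\<in>T. exp (b v * score M y v - ?n * (b v)\<^sup>2 / 2)) \<partial>coeff_prior T) =
      (\<Prod>v\<in>T. \<integral>b. exp (b * score M y v - ?n * b\<^sup>2 / 2) \<partial>std_normal)"
    unfolding coeff_prior_def
    by (rule product_sigma_finite.product_integral_prod[OF product_sigma_finite_std_normal]) (simp_all add: fin integrable_normal_exp)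
  finally show ?thesis by (simp add: integral_normal_exp)
qed

text \<open>The factor by which the joint weight of tree and data changes when a node becomes internal: \<open>q (1 - q)\<close> from the
tree prior, as one internal and one external node are gained, and the rest from the likelihood.\<close>

definition node_odds :: "nat \<Rightarrow> real \<Rightarrow> (nat \<Rightarrow> real) \<Rightarrow> node \<Rightarrow> real" where
  "node_odds M q y v = q * (1 - q) *
     (exp ((score M y v)\<^sup>2 / (2 * (real (sample_size M) + 1))) / sqrt (real (sample_size M) + 1))"

lemma node_odds_pos: "0 < q \<Longrightarrow> q < 1 \<Longrightarrow> 0 < node_odds M q y v"
  by (simp add: node_odds_def)

lemma tree_posterior_eq:
  assumes L: "L \<le> M" and q: "0 < q" "q < 1" and T: "T \<in> trees L"
  shows "tree_posterior M L (\<lambda>_. q) y T =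
    (\<Prod>v\<in>T. node_odds M q y v) / (\<Sum>S\<in>trees L. \<Prod>v\<in>S. node_odds M q y v)"
proof -
  define D where "D = (\<Prod>i\<in>{1..sample_size M}. std_normal_density (y i))"
  define Z where "Z = (\<Sum>S\<in>trees L. tree_weight (\<lambda>_. q) S)"
  have D: "D > 0" unfolding D_def by (intro prod_pos) (simp add: normal_density_pos)
  have tw: "tree_weight (\<lambda>_. q) S = (\<Prod>v\<in>S. q * (1 - q))" if "S \<in> trees L" for S
    by (simp add: tree_weight_def card_external[OF that] power_mult_distrib)
  have "Z > 0" unfolding Z_def using T q
    by (intro sum_pos) (auto simp: finite_trees tw intro!: prod_pos)
  have joint: "tree_prior L (\<lambda>_. q) S * marginal_likelihood M y S =
      D / Z * (\<Prod>v\<in>S. node_odds M q y v)" if S: "S \<in> trees L" for S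
  proof -
    have "S \<subseteq> nodes M" using S nodes_mono[OF L] by (auto simp: trees_def)
    then show ?thesis
      unfolding tree_prior_def Z_def[symmetric] tw[OF S] node_odds_def prod.distrib[of "\<lambda>_. q * (1 - q)"]
      by (subst marginal_likelihood_eq) (simp_all only: D_def[symmetric] mult_ac
          times_divide_eq_left times_divide_eq_right)
  qed
  have sum: "(\<Sum>S\<in>trees L. tree_prior L (\<lambda>_. q) S * marginal_likelihood M y S) =
      D / Z * (\<Sum>S\<in>trees L. \<Prod>v\<in>S. node_odds M q y v)"
    unfolding sum_distrib_left by (rule sum.cong) (simp_all add: joint)
  show ?thesis unfolding tree_posterior_def sum joint[OF T] using D \<open>Z > 0\<close> by simp
qed

lemma borel_measurable_tree_posterior:
  assumes "L \<le> M" "0 < q" "q < 1" "T \<in> trees L"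
  shows "(\<lambda>y. tree_posterior M L (\<lambda>_. q) y T) \<in>
    borel_measurable (Pi\<^sub>M {1..sample_size M} (\<lambda>_. borel))"
  unfolding tree_posterior_eq[OF assms] node_odds_def score_def by measurable

section \<open>Odds of the true tree against all others\<close>

lemma sum_power_card_Pow:
  fixes x :: real
  assumes "finite A"
  shows "(\<Sum>S\<in>Pow A. x ^ card S) = (1 + x) ^ card A"
  using prod_add[OF assms, of "\<lambda>_. x" "\<lambda>_. 1"] by (simp add: add.commute)

text \<open>Compared with \<open>T\<^sub>0\<close>, a tree \<open>T\<close> is described by the added nodes \<open>T - T\<^sub>0\<close> and the omitted nodes \<open>T\<^sub>0 - T\<close>, and
its odds are bounded by a product of a function of each. Dropping the constraint that \<open>T\<close> be a
tree leaves a sum over all pairs of sets, which factorizes. The geometric bound \<open>\<delta> ^ card (T\<^sub>0 - T)\<close>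
is what makes the sum over the omitted sets harmless although there may be exponentially many of them.\<close>

lemma posterior_mass_ge:
  fixes w :: "'v \<Rightarrow> real"
  assumes N: "finite N" "card N \<le> m" "\<T> \<subseteq> Pow N" "T\<^sub>0 \<in> \<T>"
    and w: "\<And>v. v \<in> N \<Longrightarrow> 0 < w v"
    and over: "\<And>v. v \<in> N - T\<^sub>0 \<Longrightarrow> w v \<le> q" and q: "0 \<le> q"
    and under: "\<And>T. T \<in> \<T> \<Longrightarrow> \<not> T\<^sub>0 \<subseteq> T \<Longrightarrow>
      (\<Prod>v\<in>T\<^sub>0 - T. 1 / w v) \<le> \<eta> * \<delta> ^ card (T\<^sub>0 - T)"
    and \<eta>: "0 \<le> \<eta>" and \<delta>: "0 \<le> \<delta>"
  shows "1 / ((1 + q) ^ m * (1 + \<eta> * (1 + \<delta>) ^ m)) \<le> (\<Prod>v\<in>T\<^sub>0. w v) / (\<Sum>T\<in>\<T>. \<Prod>v\<in>T. w v)"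
proof -
  have fin: "finite T" if "T \<subseteq> N" for T using that N(1) finite_subset by blast
  have T0: "T\<^sub>0 \<subseteq> N" using N by auto
  have posw: "0 < (\<Prod>v\<in>T. w v)" if "T \<subseteq> N" for T using that w by (intro prod_pos) auto
  \<comment> \<open>The empty set gets \<open>1 + \<eta>\<close> instead of \<open>1\<close>; the excess turns the sum over the nonempty
    sets into one over the whole power set.\<close>
  define under_bound where "under_bound U = (if U = {} then 1 else 0) + \<eta> * \<delta> ^ card U" for U :: "'v set"
  define bound where "bound = (\<lambda>(S, U :: 'v set). q ^ card (S :: 'v set) * under_bound U)"
  define split where "split T = (T - T\<^sub>0, T\<^sub>0 - T)" for T
  have bound_nonneg: "0 \<le> bound p" for p
    using q \<eta> \<delta> by (auto simp: bound_def under_bound_def split: prod.splits)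
  have ratio: "(\<Prod>v\<in>T. w v) / (\<Prod>v\<in>T\<^sub>0. w v) \<le> bound (split T)" if T: "T \<in> \<T>" for T
  proof -
    have TN: "T \<subseteq> N" using T N by auto
    have "(\<Prod>v\<in>T. w v) = (\<Prod>v\<in>T - T\<^sub>0. w v) * (\<Prod>v\<in>T \<inter> T\<^sub>0. w v)"
      using fin[OF TN] by (subst prod.union_disjoint[symmetric]) (auto simp: Un_Diff_Int intro!: prod.cong)
    moreover have "(\<Prod>v\<in>T\<^sub>0. w v) = (\<Prod>v\<in>T\<^sub>0 - T. w v) * (\<Prod>v\<in>T \<inter> T\<^sub>0. w v)"
      using fin[OF T0] by (subst prod.union_disjoint[symmetric]) (auto intro!: prod.cong)
    moreover have "0 < (\<Prod>v\<in>T \<inter> T\<^sub>0. w v)" using TN by (intro posw) auto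
    ultimately have "(\<Prod>v\<in>T. w v) / (\<Prod>v\<in>T\<^sub>0. w v) = (\<Prod>v\<in>T - T\<^sub>0. w v) * (\<Prod>v\<in>T\<^sub>0 - T. 1 / w v)"
      by (simp add: prod_dividef)
    also have "\<dots> \<le> q ^ card (T - T\<^sub>0) * under_bound (T\<^sub>0 - T)"
    proof (rule mult_mono)
      have "(\<Prod>v\<in>T - T\<^sub>0. w v) \<le> (\<Prod>v\<in>T - T\<^sub>0. q)"
        using TN w over by (intro prod_mono) (auto simp: less_imp_le)
      then show "(\<Prod>v\<in>T - T\<^sub>0. w v) \<le> q ^ card (T - T\<^sub>0)" by simp
      show "(\<Prod>v\<in>T\<^sub>0 - T. 1 / w v) \<le> under_bound (T\<^sub>0 - T)"
      proof (cases "T\<^sub>0 \<subseteq> T")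
        case True
        then have "T\<^sub>0 - T = {}" by blast
        then show ?thesis unfolding under_bound_def using \<eta> by (simp only:) simp
      next
        case False
        then show ?thesis using under[OF T False] by (auto simp: under_bound_def)
      qed
      show "0 \<le> (\<Prod>v\<in>T\<^sub>0 - T. 1 / w v)" using T0 w by (intro prod_nonneg) (auto simp: less_imp_le)
    qed (use q in simp)
    finally show ?thesis by (simp add: bound_def split_def)
  qed
  have inj: "inj_on split \<T>" by (rule inj_onI) (auto simp: split_def)
  have "(\<Sum>T\<in>\<T>. \<Prod>v\<in>T. w v) / (\<Prod>v\<in>T\<^sub>0. w v) \<le> (\<Sum>T\<in>\<T>. bound (split T))"
    unfolding sum_divide_distrib by (rule sum_mono) (rule ratio)
  also have "\<dots> = (\<Sum>p\<in>split ` \<T>. bound p)" by (simp add: sum.reindex[OF inj])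
  also have "\<dots> \<le> (\<Sum>p\<in>Pow N \<times> Pow T\<^sub>0. bound p)"
  proof (rule sum_mono2)
    show "split ` \<T> \<subseteq> Pow N \<times> Pow T\<^sub>0" using N by (auto simp: split_def)
  qed (use N(1) fin[OF T0] bound_nonneg in auto)
  also have "\<dots> = (\<Sum>S\<in>Pow N. q ^ card S) * (\<Sum>U\<in>Pow T\<^sub>0. under_bound U)"
    unfolding bound_def by (simp add: sum_product sum.cartesian_product)
  also have "(\<Sum>U\<in>Pow T\<^sub>0. under_bound U) = 1 + \<eta> * (1 + \<delta>) ^ card T\<^sub>0"
    unfolding under_bound_def sum.distrib
    using fin[OF T0] by (simp add: sum_power_card_Pow flip: sum_distrib_left)
  also have "(\<Sum>S\<in>Pow N. q ^ card S) = (1 + q) ^ card N"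
    by (rule sum_power_card_Pow[OF N(1)])
  also have "(1 + q) ^ card N * (1 + \<eta> * (1 + \<delta>) ^ card T\<^sub>0) \<le> (1 + q) ^ m * (1 + \<eta> * (1 + \<delta>) ^ m)"
  proof -
    have "card T\<^sub>0 \<le> m" using card_mono[OF N(1) T0] N(2) by linarith
    then show ?thesis using N(2) q \<eta> \<delta>
      by (intro mult_mono add_mono power_increasing order_refl) auto
  qed
  finally have le: "(\<Sum>T\<in>\<T>. \<Prod>v\<in>T. w v) / (\<Prod>v\<in>T\<^sub>0. w v) \<le> (1 + q) ^ m * (1 + \<eta> * (1 + \<delta>) ^ m)" .
  have "finite \<T>" using N finite_subset by blast
  then have "0 < (\<Sum>T\<in>\<T>. \<Prod>v\<in>T. w v)" using N posw by (intro sum_pos) auto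
  then have "0 < (\<Sum>T\<in>\<T>. \<Prod>v\<in>T. w v) / (\<Prod>v\<in>T\<^sub>0. w v)" using posw[OF T0] by simp
  then have "1 / ((1 + q) ^ m * (1 + \<eta> * (1 + \<delta>) ^ m)) \<le>
      1 / ((\<Sum>T\<in>\<T>. \<Prod>v\<in>T. w v) / (\<Prod>v\<in>T\<^sub>0. w v))"
    using le by (intro frac_le) auto
  then show ?thesis by simp
qed

text \<open>With at most \<open>n / 2\<close> nodes, weight \<open>x / n\<close> per added node and a factor \<open>1 / n\<close> per omitted node, both powers are bounded
by exponentials; the factor \<open>1/2\<close> in front of \<open>e\<close> absorbs \<open>exp (1/2) \<le> 2\<close>.\<close>

lemma one_minus_le_inverse_growth:
  fixes x e n :: real
  assumes n: "1 \<le> n" and m: "real m \<le> n / 2" and x: "0 \<le> x" and e: "0 \<le> e"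
  shows "1 - x / 2 - e \<le> 1 / ((1 + x / n) ^ m * (1 + e / 2 * (1 + 1 / n) ^ m))"
proof -
  have growth: "(1 + r / n) ^ m \<le> exp (r / 2)" if r: "0 \<le> r" for r
  proof -
    have "(1 + r / n) ^ m \<le> exp (r / n) ^ m"
      using r n by (intro power_mono exp_ge_add_one_self) (auto intro: add_nonneg_nonneg)
    also have "\<dots> = exp (real m * (r / n))" by (rule exp_of_nat_mult[symmetric])
    also have "real m * (r / n) \<le> n / 2 * (r / n)" using m r n by (intro mult_right_mono) auto
    also have "n / 2 * (r / n) = r / 2" using n by simp
    finally show ?thesis by simp
  qed
  have "exp (1 / 2 :: real) \<le> 2"
  proof -
    have "exp (1 / 2 :: real) ^ 2 = exp 1" by (simp flip: exp_of_nat_mult)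
    also have "\<dots> \<le> 2 ^ 2" using exp_le by simp
    finally show ?thesis by (rule power2_le_imp_le) simp
  qed
  then have "(1 + 1 / n) ^ m \<le> 2" using growth[of 1] by simp
  then have "1 + e / 2 * (1 + 1 / n) ^ m \<le> 1 + e"
    using mult_left_mono[of _ 2 "e / 2"] e by fastforce
  also have "\<dots> \<le> exp e" by (rule exp_ge_add_one_self)
  finally have "(1 + x / n) ^ m * (1 + e / 2 * (1 + 1 / n) ^ m) \<le> exp (x / 2) * exp e"
    using growth[OF x] n e by (intro mult_mono) auto
  moreover have "0 < (1 + x / n) ^ m * (1 + e / 2 * (1 + 1 / n) ^ m)"
    using n x e by (intro mult_pos_pos zero_less_power add_pos_nonneg) auto
  ultimately have "1 / (exp (x / 2) * exp e) \<le> 1 / ((1 + x / n) ^ m * (1 + e / 2 * (1 + 1 / n) ^ m))"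
    by (intro divide_left_mono) auto
  moreover have "1 / (exp (x / 2) * exp e) = exp (- (x / 2 + e))"
    unfolding exp_add[symmetric] by (metis exp_minus inverse_eq_divide)
  ultimately show ?thesis using exp_ge_add_one_self[of "- (x / 2 + e)"] by linarith
qed

section \<open>Bounds for the node weights\<close>

lemma sample_size_ge_1: "1 \<le> real (sample_size M)"
  unfolding sample_size_def of_nat_power by (rule one_le_power) simp

lemma node_odds_noise_le:
  fixes n :: real and M :: nat
  defines "n \<equiv> real (sample_size M)"
  assumes s: "\<bar>score M y v\<bar> \<le> 2 * sqrt (n * ln n)"
  shows "node_odds M (n powr (- c)) y v \<le> n powr (3 / 2 - c)"
proof -
  have n: "1 \<le> n" unfolding n_def by (rule sample_size_ge_1)
  have "(score M y v)\<^sup>2 \<le> (2 * sqrt (n * ln n))\<^sup>2"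
    using power_mono[OF s, of 2] by simp
  also have "\<dots> = 4 * (n * ln n)" using n by (simp add: power_mult_distrib)
  finally have "(score M y v)\<^sup>2 / (2 * (n + 1)) \<le> 4 * (n * ln n) / (2 * (n + 1))"
    using n by (intro divide_right_mono) auto
  also have "\<dots> \<le> 2 * ln n"
    using n by (simp add: field_simps)
  finally have "exp ((score M y v)\<^sup>2 / (2 * (n + 1))) \<le> n powr 2"
    using n by (simp add: powr_def)
  moreover have "n powr (1 / 2) \<le> sqrt (n + 1)"
    using n by (simp add: powr_half_sqrt)
  ultimately have "exp ((score M y v)\<^sup>2 / (2 * (n + 1))) / sqrt (n + 1) \<le> n powr 2 / n powr (1 / 2)"
    using n by (intro frac_le) auto
  moreover have "n powr (- c) * (1 - n powr (- c)) \<le> n powr (- c)"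
    by (simp add: mult_left_le)
  ultimately have "node_odds M (n powr (- c)) y v \<le> n powr (- c) * (n powr 2 / n powr (1 / 2))"
    unfolding node_odds_def n_def[symmetric] using n by (intro mult_mono) auto
  also have "\<dots> = n powr (- c + (2 - 1 / 2))"
    unfolding powr_diff powr_add ..
  finally show ?thesis by simp
qed

text \<open>The factors \<open>1 / (1 - q)\<close> and \<open>sqrt (n + 1)\<close> are bounded crudely by \<open>n\<close> each, which gives the \<open>2\<close> in the exponent.\<close>

lemma inverse_node_odds_le:
  fixes n :: real and M :: nat
  defines "n \<equiv> real (sample_size M)"
  assumes M: "1 \<le> M" and c: "1 \<le> c"
  shows "1 / node_odds M (n powr (- c)) y v \<le> n powr (c + 2) * exp (- ((score M y v)\<^sup>2 / (2 * (n + 1))))"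
proof -
  define q where "q = n powr (- c)"
  define e where "e = exp ((score M y v)\<^sup>2 / (2 * (n + 1)))"
  have "(2::real) ^ 1 \<le> 2 ^ M" using M by (intro power_increasing) auto
  then have n: "4 \<le> n" by (simp add: n_def sample_size_def)
  have "q \<le> n powr (- 1)" unfolding q_def using n c by (intro powr_mono) auto
  also have "\<dots> \<le> 1 / 2" using n by (simp add: powr_minus field_simps)
  finally have q: "0 < q" "q \<le> 1 / 2" using n by (auto simp: q_def)
  have q1: "1 / (1 - q) \<le> n"
  proof -
    have "1 / (1 - q) \<le> 1 / (1 / 2)" using q by (intro divide_left_mono) auto
    then show ?thesis using n by simp
  qed
  have "4 * n \<le> n * n" using n by (intro mult_right_mono) auto
  then have "n + 1 \<le> n * n" using n by linarith
  then have sq: "sqrt (n + 1) \<le> n" using n by (intro real_le_lsqrt) (auto simp: power2_eq_square)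
  have "1 / node_odds M q y v = 1 / q * (1 / (1 - q) * sqrt (n + 1)) * (1 / e)"
    unfolding node_odds_def n_def[symmetric] e_def[symmetric] by simp
  also have "\<dots> \<le> 1 / q * (n * n) * (1 / e)"
    using q n q1 sq by (intro mult_right_mono mult_left_mono mult_mono) (auto simp: e_def)
  also have "1 / q * (n * n) = n powr (c + 2)"
    using n by (simp add: q_def powr_add powr_minus power2_eq_square field_simps)
  also have "1 / e = exp (- ((score M y v)\<^sup>2 / (2 * (n + 1))))"
    by (simp add: e_def exp_minus inverse_eq_divide)
  finally show ?thesis unfolding q_def .
qed

text \<open>The signal contributes at least \<open>A \<surd>n ln n\<close> to the score and the noise takes away at most \<open>2 \<surd>n ln n\<close>. For \<open>A \<ge> 8\<close>
the remainder is at least three quarters of the signal, and \<open>9/16 * n \<ge> (n + 1) / 2\<close>, which leaves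
the constant \<open>1/4\<close>.\<close>

lemma signal_score_ge:
  fixes n :: real
  assumes n: "8 \<le> n" "1 \<le> ln n" and A: "8 \<le> A"
    and noise: "\<bar>s - n * b\<bar> \<le> 2 * sqrt (n * ln n)" and b: "A * ln n / sqrt n \<le> \<bar>b\<bar>"
  shows "A\<^sup>2 / 4 * (ln n)\<^sup>2 \<le> s\<^sup>2 / (2 * (n + 1))"
proof -
  have "sqrt (ln n) \<le> ln n" using n(2) by (intro real_le_lsqrt) (auto simp: power2_eq_square)
  then have "2 * sqrt (n * ln n) \<le> sqrt n * (2 * ln n)"
    using n by (simp add: real_sqrt_mult)
  moreover have "sqrt n * (A * ln n) \<le> n * \<bar>b\<bar>"
  proof -
    have "n * (A * ln n / sqrt n) \<le> n * \<bar>b\<bar>" using n b by (intro mult_left_mono) auto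
    moreover have "n * (A * ln n / sqrt n) = sqrt n * (A * ln n)"
      using n real_div_sqrt[of n] by (simp add: field_simps)
    ultimately show ?thesis by simp
  qed
  moreover have "n * \<bar>b\<bar> \<le> \<bar>s\<bar> + \<bar>s - n * b\<bar>"
    using n by (simp add: abs_mult[symmetric, of n b, simplified] abs_mult)
  ultimately have "sqrt n * (A * ln n) - sqrt n * (2 * ln n) \<le> \<bar>s\<bar>" using noise by linarith
  then have s: "sqrt n * ((A - 2) * ln n) \<le> \<bar>s\<bar>" by (simp add: algebra_simps)
  have "sqrt n * (3 / 4 * A * ln n) \<le> sqrt n * ((A - 2) * ln n)"
    using n A by (intro mult_left_mono mult_right_mono) auto
  then have "sqrt n * (3 / 4 * A * ln n) \<le> \<bar>s\<bar>" using s by linarith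
  then have "(sqrt n * (3 / 4 * A * ln n))\<^sup>2 \<le> s\<^sup>2"
    using n A power_mono[of "sqrt n * (3 / 4 * A * ln n)" "\<bar>s\<bar>" 2] by auto
  then have "n * (9 / 16 * (A\<^sup>2 * (ln n)\<^sup>2)) \<le> s\<^sup>2"
    using n by (simp add: power_mult_distrib power_divide)
  moreover have "(2 * (n + 1)) * (A\<^sup>2 / 4 * (ln n)\<^sup>2) \<le> n * (9 / 16 * (A\<^sup>2 * (ln n)\<^sup>2))"
  proof -
    have "(2 * (n + 1) / 4) * (A\<^sup>2 * (ln n)\<^sup>2) \<le> (9 / 16 * n) * (A\<^sup>2 * (ln n)\<^sup>2)"
      using n by (intro mult_right_mono) auto
    then show ?thesis by (simp add: mult_ac)
  qed
  ultimately have "(2 * (n + 1)) * (A\<^sup>2 / 4 * (ln n)\<^sup>2) \<le> s\<^sup>2" by linarith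
  then have "A\<^sup>2 / 4 * (ln n)\<^sup>2 * (2 * (n + 1)) \<le> s\<^sup>2" by (simp only: mult.commute)
  moreover have "0 < 2 * (n + 1)" using n by simp
  ultimately show ?thesis by (simp only: pos_le_divide_eq)
qed

text \<open>Here \<open>l = ln n\<close>, \<open>u\<close> is the number of omitted nodes and \<open>b\<close> the number of omitted signals. Half of the exponent \<open>A\<^sup>2/4\<close> of a
single signal pays for the omitted nodes, at \<open>c + 3\<close> instead of \<open>c + 2\<close> powers of \<open>n\<close> each to provide the summability
factor \<open>1 / n\<close>, and for a constant factor \<open>exp (-1) \<le> 1/2\<close>. The other half is the final rate.\<close>

lemma missing_nodes_exponent:
  fixes A c l :: real and L u b :: nat
  assumes c: "0 \<le> c" and l: "1 \<le> l" "2 / 3 * real L \<le> l" and A: "12 * c + 44 \<le> A\<^sup>2"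
    and u: "u \<le> L * b" and b: "1 \<le> b"
  shows "(c + 3) * l * real u - A\<^sup>2 / 4 * l\<^sup>2 * real b \<le> - (A\<^sup>2 / 8 * l\<^sup>2) - 1"
proof -
  define k where "k = 3 / 2 * (c + 3)"
  have k: "1 \<le> A\<^sup>2 / 8 - k" using A unfolding k_def by argo
  have "real u \<le> real L * real b" using u by (simp flip: of_nat_mult)
  also have "\<dots> \<le> 3 / 2 * l * real b" using l by (intro mult_right_mono) auto
  finally have "(c + 3) * l * real u \<le> (c + 3) * l * (3 / 2 * l * real b)"
    using c l by (intro mult_left_mono) auto
  also have "\<dots> = k * (l\<^sup>2 * real b)" by (simp add: k_def power2_eq_square)
  finally have "(c + 3) * l * real u \<le> k * (l\<^sup>2 * real b)" .
  moreover have "(A\<^sup>2 / 4 - k) * (l\<^sup>2 * 1) \<le> (A\<^sup>2 / 4 - k) * (l\<^sup>2 * real b)"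
  proof -
    have "0 \<le> A\<^sup>2 / 4 - k" using k zero_le_power2[of A] by linarith
    then show ?thesis using b by (intro mult_left_mono) auto
  qed
  moreover have "1 * 1 \<le> (A\<^sup>2 / 8 - k) * l\<^sup>2"
    using k l by (intro mult_mono) (auto simp: one_le_power)
  moreover have "A\<^sup>2 / 4 * l\<^sup>2 * real b = A\<^sup>2 / 4 * (l\<^sup>2 * real b)" by simp
  ultimately show ?thesis
    unfolding left_diff_distrib mult_1_right by linarith
qed
text \<open>The deterministic part of the theorem. The true tree loses a factor \<open>exp (- n powr (5/2 - c) / 2)\<close> to the trees with
additional nodes and a factor \<open>exp (- E)\<close> to the trees
that miss a signal, where \<open>E\<close> is the last term of the bound.\<close>

lemma tree_posterior_ge:
  fixes n c A :: real and M :: nat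
  defines "n \<equiv> real (sample_size M)"
  assumes M: "2 \<le> M" and L: "L \<le> M" and c: "5 / 2 < c" and A: "12 * c + 44 \<le> A"
    and B: "B \<subseteq> nodes L" and \<beta>: "\<And>v. v \<in> B \<Longrightarrow> A * ln n / sqrt n < \<bar>\<beta> v\<bar>"
    and noise: "\<And>v. v \<in> nodes M \<Longrightarrow>
      \<bar>score M y v - n * (if v \<in> B then \<beta> v else 0)\<bar> < 2 * sqrt (n * ln n)"
  shows "1 - n powr (5 / 2 - c) / 2 - exp (- (A\<^sup>2 / 8 * (ln n)\<^sup>2)) \<le>
    tree_posterior M L (\<lambda>_. n powr (- c)) y (smallest_tree L B)"
proof -
  define l where "l = ln n"
  define E where "E = exp (- (A\<^sup>2 / 8 * l\<^sup>2))"
  define \<rho> where "\<rho> = exp (- (A\<^sup>2 / 4 * l\<^sup>2))"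
  define w where "w = node_odds M (n powr (- c)) y"
  define T0 where "T0 = smallest_tree L B"
  have n_eq: "n = 2 ^ Suc M" by (simp add: n_def sample_size_def)
  have "(2::real) ^ 3 \<le> 2 ^ Suc M" using M by (intro power_increasing) auto
  then have n8: "8 \<le> n" by (simp add: n_eq)
  have l_eq: "l = real (Suc M) * ln 2" unfolding l_def n_eq by (rule ln_realpow)
  have lM: "real (Suc M) * (2 / 3) \<le> l"
    unfolding l_eq using ln2_ge_two_thirds by (intro mult_left_mono) auto
  then have l: "1 \<le> l" "2 / 3 * real L \<le> l" using M L by auto
  have A8: "8 \<le> A" using A c by simp
  then have "A * 1 \<le> A * A" by (intro mult_left_mono) auto
  then have A2: "12 * c + 44 \<le> A\<^sup>2" using A by (simp add: power2_eq_square)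
  have q: "0 < n powr (- c)" "n powr (- c) < 1"
    using n8 c powr_less_mono[of "- c" 0 n] by auto
  have LM: "nodes L \<subseteq> nodes M" by (rule nodes_mono[OF L])
  note T0 = smallest_tree[OF B, folded T0_def]
  have inv: "1 / w v \<le> n powr (c + 2) * (if v \<in> B then \<rho> else 1)" if v: "v \<in> nodes L" for v
  proof -
    have "1 / w v \<le> n powr (c + 2) * exp (- ((score M y v)\<^sup>2 / (2 * (n + 1))))"
      unfolding w_def n_def using M c by (intro inverse_node_odds_le) auto
    also have "exp (- ((score M y v)\<^sup>2 / (2 * (n + 1)))) \<le> (if v \<in> B then \<rho> else 1)"
    proof (cases "v \<in> B")
      case True
      have "A\<^sup>2 / 4 * (ln n)\<^sup>2 \<le> (score M y v)\<^sup>2 / (2 * (n + 1))"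
        by (rule signal_score_ge[where b = "\<beta> v"])
          (use n8 l A8 noise[of v] \<beta>[OF True] True v LM in \<open>auto simp: l_def\<close>)
      then show ?thesis using True by (simp add: \<rho>_def l_def)
    qed (use n8 in simp)
    finally show ?thesis by (simp add: mult_left_mono)
  qed
  have "1 - n powr (5 / 2 - c) / 2 - E \<le>
      1 / ((1 + n powr (5 / 2 - c) / n) ^ 2 ^ M * (1 + E / 2 * (1 + 1 / n) ^ 2 ^ M))"
    using n8 by (intro one_minus_le_inverse_growth) (auto simp: n_eq E_def)
  also have "\<dots> \<le> (\<Prod>v\<in>T0. w v) / (\<Sum>T\<in>trees L. \<Prod>v\<in>T. w v)"
  proof (rule posterior_mass_ge[OF finite_nodes])
    show "card (nodes L) \<le> 2 ^ M"
      using card_mono[OF finite_nodes LM] card_nodes[of M] by linarith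
    show "trees L \<subseteq> Pow (nodes L)" by (auto simp: trees_def)
    show "T0 \<in> trees L" by (rule T0(1))
    show "0 < w v" for v unfolding w_def by (rule node_odds_pos[OF q])
    show "w v \<le> n powr (5 / 2 - c) / n" if v: "v \<in> nodes L - T0" for v
    proof -
      have "v \<notin> B" "v \<in> nodes M" using v T0(2) LM by auto
      then have "w v \<le> n powr (3 / 2 - c)"
        unfolding w_def n_def using noise[of v]
        by (intro node_odds_noise_le) (simp add: n_def)
      also have "\<dots> = n powr (5 / 2 - c - 1)" by simp
      also have "\<dots> = n powr (5 / 2 - c) / n" using n8 by (subst powr_diff) simp
      finally show ?thesis .
    qed
    show "(\<Prod>v\<in>T0 - T. 1 / w v) \<le> E / 2 * (1 / n) ^ card (T0 - T)"
      if T: "T \<in> trees L" and miss: "\<not> T0 \<subseteq> T" for T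
    proof -
      let ?u = "card (T0 - T)" and ?b = "card (B - T)"
      have T0N: "T0 \<subseteq> nodes L" using T0(1) by (auto simp: trees_def)
      have fin: "finite (T0 - T)" "finite (B - T)"
        using finite_subset[OF T0N finite_nodes] finite_subset[OF B finite_nodes] by auto
      have "B - T \<noteq> {}" using miss T0(3)[OF T] by blast
      then have b: "1 \<le> ?b" using fin(2) by (simp add: Suc_le_eq card_gt_0_iff)
      have "(\<Prod>v\<in>T0 - T. 1 / w v) \<le> (\<Prod>v\<in>T0 - T. n powr (c + 2) * (if v \<in> B then \<rho> else 1))"
        using T0N by (intro prod_mono conjI inv) (auto simp: w_def node_odds_pos[OF q] less_imp_le)
      also have "\<dots> = (n powr (c + 2)) ^ ?u * (\<Prod>v\<in>T0 - T. if v \<in> B then \<rho> else 1)"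
        by (simp add: prod.distrib)
      also have "(\<Prod>v\<in>T0 - T. if v \<in> B then \<rho> else 1) = (\<Prod>v\<in>B - T. \<rho>)"
        using fin T0(2) by (intro prod.mono_neutral_cong_right) auto
      also have "(n powr (c + 2)) ^ ?u * (\<Prod>v\<in>B - T. \<rho>) =
          exp ((c + 3) * l * real ?u - A\<^sup>2 / 4 * l\<^sup>2 * real ?b) * exp (- l * real ?u)"
        using n8 by (simp add: \<rho>_def powr_def l_def algebra_simps flip: exp_of_nat_mult exp_add)
      also have "\<dots> \<le> exp (- (A\<^sup>2 / 8 * l\<^sup>2) - 1) * exp (- l * real ?u)"
        using c l A2 b card_missing_le[OF T B]
        by (intro mult_right_mono iffD2[OF exp_le_cancel_iff] missing_nodes_exponent[where L = L])
          (auto simp: T0_def)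
      also have "exp (- l * real ?u) = (1 / n) ^ ?u"
      proof -
        have "exp (- l) = 1 / n" using n8 by (simp add: l_def exp_minus inverse_eq_divide)
        then show ?thesis by (metis exp_of_nat_mult mult.commute)
      qed
      also have "exp (- (A\<^sup>2 / 8 * l\<^sup>2) - 1) = E * (1 / exp 1)"
        by (simp add: E_def exp_diff)
      also have "\<dots> * (1 / n) ^ ?u \<le> E * (1 / 2) * (1 / n) ^ ?u"
        using exp_ge_add_one_self[of 1] n8
        by (intro mult_right_mono mult_left_mono divide_left_mono) (auto simp: E_def)
      finally show ?thesis by simp
    qed
  qed (use n8 in \<open>auto simp: E_def\<close>)
  also have "\<dots> = tree_posterior M L (\<lambda>_. n powr (- c)) y T0"
    unfolding w_def by (rule tree_posterior_eq[OF L q T0(1), symmetric])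
  finally show ?thesis by (simp add: E_def T0_def l_def)
qed

section \<open>Uniform control of the noise\<close>

text \<open>Chernoff's bound; the linear form is normal with variance \<open>s\<close>, and \<open>c = t / s\<close> is the optimal exponent.\<close>

lemma normal_linear_form_tail:
  fixes a :: "'i \<Rightarrow> real"
  assumes fin: "finite I" and s: "(\<Sum>i\<in>I. (a i)\<^sup>2) = s" "0 < s" and t: "0 \<le> t"
  shows "measure (Pi\<^sub>M I (\<lambda>_. std_normal))
      {x \<in> space (Pi\<^sub>M I (\<lambda>_. std_normal)). t \<le> (\<Sum>i\<in>I. a i * x i)} \<le> exp (- t\<^sup>2 / (2 * s))"
proof (cases "t = 0")
  case True
  then show ?thesis
    using prob_space.prob_le_1[OF prob_space_PiM[OF prob_space_std_normal]] by simp
next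
  case False
  let ?P = "Pi\<^sub>M I (\<lambda>_. std_normal)"
  define c where "c = t / s"
  have c: "c > 0" using t False s by (simp add: c_def)
  let ?u = "\<lambda>x. \<Prod>i\<in>I. exp (x i * (c * a i) - 0 * (x i)\<^sup>2 / 2)"
  have u: "?u x = exp (c * (\<Sum>i\<in>I. a i * x i))" for x
    using fin by (simp add: exp_sum sum_distrib_left mult_ac)
  have int: "integrable ?P ?u"
    by (rule product_sigma_finite.product_integrable_prod[OF product_sigma_finite_std_normal fin]) (rule integrable_normal_exp, simp)
  have "(\<integral>x. ?u x \<partial>?P) = (\<Prod>i\<in>I. \<integral>x. exp (x * (c * a i) - 0 * x\<^sup>2 / 2) \<partial>std_normal)"
    by (rule product_sigma_finite.product_integral_prod[OF product_sigma_finite_std_normal fin])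
      (rule integrable_normal_exp, simp)
  also have "\<dots> = (\<Prod>i\<in>I. exp ((c * a i)\<^sup>2 / (2 * (0 + 1))) / sqrt (0 + 1))"
    by (intro prod.cong refl integral_normal_exp) simp
  also have "\<dots> = exp (c\<^sup>2 * s / 2)"
    using fin s(1) by (simp add: power_mult_distrib flip: exp_sum sum_divide_distrib sum_distrib_left)
  finally have mgf: "(\<integral>x. ?u x \<partial>?P) = exp (c\<^sup>2 * s / 2)" .
  have "measure ?P {x \<in> space ?P. t \<le> (\<Sum>i\<in>I. a i * x i)} =
      measure ?P {x \<in> space ?P. exp (c * t) \<le> ?u x}"
    unfolding u using c by simp
  also have "\<dots> \<le> (\<integral>x. ?u x \<partial>?P) / exp (c * t)"
    by (rule integral_Markov_inequality_measure[OF int, of "{}"]) (auto intro!: prod_nonneg)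
  also have "\<dots> = exp (c\<^sup>2 * s / 2 - c * t)" unfolding mgf by (rule exp_diff[symmetric])
  also have "c\<^sup>2 * s / 2 - c * t = - t\<^sup>2 / (2 * s)"
    using s(2) by (simp add: c_def power2_eq_square field_simps)
  finally show ?thesis .
qed

lemma normal_linear_forms_bounded:
  fixes a :: "'v \<Rightarrow> 'i \<Rightarrow> real"
  assumes fin: "finite I" "finite V" and s: "\<And>v. v \<in> V \<Longrightarrow> (\<Sum>i\<in>I. (a v i)\<^sup>2) = s" "0 < s"
    and t: "0 \<le> t"
  shows "1 - 2 * real (card V) * exp (- t\<^sup>2 / (2 * s)) \<le> measure (Pi\<^sub>M I (\<lambda>_. std_normal))
      {x \<in> space (Pi\<^sub>M I (\<lambda>_. std_normal)). \<forall>v\<in>V. \<bar>\<Sum>i\<in>I. a v i * x i\<bar> < t}"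
proof -
  let ?P = "Pi\<^sub>M I (\<lambda>_. std_normal)" and ?e = "exp (- t\<^sup>2 / (2 * s))"
  define bad where "bad b v = {x \<in> space ?P. t \<le> (\<Sum>i\<in>I. b * a v i * x i)}" for b v
  have sets: "bad b v \<in> sets ?P" for b v unfolding bad_def by measurable
  have tail: "measure ?P (bad b v) \<le> ?e" if "v \<in> V" "b\<^sup>2 = 1" for b v
    unfolding bad_def using that s t
    by (intro normal_linear_form_tail[OF fin(1)]) (auto simp: power_mult_distrib)
  have good: "{x \<in> space ?P. \<forall>v\<in>V. \<bar>\<Sum>i\<in>I. a v i * x i\<bar> < t} =
      space ?P - (\<Union>v\<in>V. bad 1 v \<union> bad (-1) v)"
    by (auto simp: bad_def sum_negf abs_less_iff not_le; force)
  have "measure ?P (\<Union>v\<in>V. bad 1 v \<union> bad (-1) v) \<le> (\<Sum>v\<in>V. measure ?P (bad 1 v \<union> bad (-1) v))"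
    by (rule measure_UNION_le[OF fin(2)]) (use sets in auto)
  also have "\<dots> \<le> (\<Sum>v\<in>V. 2 * ?e)"
  proof (rule sum_mono)
    fix v assume v: "v \<in> V"
    have "measure ?P (bad 1 v \<union> bad (-1) v) \<le> measure ?P (bad 1 v) + measure ?P (bad (-1) v)"
      by (rule measure_Un_le) (rule sets)+
    then show "measure ?P (bad 1 v \<union> bad (-1) v) \<le> 2 * ?e"
      using tail[OF v, of 1] tail[OF v, of "-1"] by simp
  qed
  finally have "measure ?P (\<Union>v\<in>V. bad 1 v \<union> bad (-1) v) \<le> 2 * real (card V) * ?e"
    by (simp add: mult_ac)
  moreover have "(\<Union>v\<in>V. bad 1 v \<union> bad (-1) v) \<in> sets ?P"
    using sets fin(2) by (intro sets.finite_UN) auto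
  ultimately show ?thesis
    unfolding good by (subst prob_space.prob_compl[OF prob_space_PiM[OF prob_space_std_normal]]) auto
qed

text \<open>Orthogonality again: the scores recover the coefficients of the regression function.\<close>

lemma score_signal:
  assumes "B \<subseteq> nodes M" "v \<in> nodes M"
    and f0: "\<And>x. x \<in> {0..1} \<Longrightarrow> f0 x = (\<Sum>w\<in>B. \<beta> w * haar w x)"
  shows "score M (\<lambda>i. f0 (design_point (sample_size M) i) + eps i) v =
    real (sample_size M) * (if v \<in> B then \<beta> v else 0) + score M eps v"
proof -
  let ?I = "{1..sample_size M}" and ?X = "design_matrix M"
  have fin: "finite B" using assms(1) finite_nodes finite_subset by blast
  have f: "f0 (design_point (sample_size M) i) = (\<Sum>w\<in>B. \<beta> w * ?X i w)" if "i \<in> ?I" for i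
  proof -
    have "design_point (sample_size M) i \<in> {0..1}" using that by (auto simp: design_point_def)
    then show ?thesis by (simp add: f0 design_matrix_def)
  qed
  have "(\<Sum>i\<in>?I. ?X i v * f0 (design_point (sample_size M) i)) =
      (\<Sum>i\<in>?I. \<Sum>w\<in>B. \<beta> w * (?X i v * ?X i w))"
    by (intro sum.cong refl) (simp add: f sum_distrib_left mult_ac)
  also have "\<dots> = (\<Sum>w\<in>B. \<beta> w * (\<Sum>i\<in>?I. ?X i v * ?X i w))"
    unfolding sum_distrib_left by (rule sum.swap)
  also have "\<dots> = (\<Sum>w\<in>B. if v = w then \<beta> w * real (sample_size M) else 0)"
    using assms(1,2) by (intro sum.cong refl) (subst design_orthogonal, auto)
  also have "\<dots> = real (sample_size M) * (if v \<in> B then \<beta> v else 0)"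
    using fin by simp
  finally show ?thesis by (simp add: score_def distrib_left sum.distrib)
qed

text \<open>The threshold is two standard deviations times \<open>\<surd>(ln n)\<close>, so that each of the at most \<open>n / 2\<close> scores exceeds it in absolute value
with probability at most \<open>2 / n\<^sup>2\<close>.\<close>

lemma noise_bounded:
  fixes n :: real and M :: nat
  defines "n \<equiv> real (sample_size M)"
  shows "1 - 4 / n \<le> measure (Pi\<^sub>M {1..sample_size M} (\<lambda>_. std_normal))
    {eps \<in> space (Pi\<^sub>M {1..sample_size M} (\<lambda>_. std_normal)).
      \<forall>v\<in>nodes M. \<bar>score M eps v\<bar> < 2 * sqrt (n * ln n)}"
proof -
  have n: "n = 2 * 2 ^ M" "1 \<le> n" using sample_size_ge_1 by (simp_all add: n_def sample_size_def)
  have "0 \<le> n * ln n" using n(2) by (intro mult_nonneg_nonneg) auto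
  then have "exp (- (2 * sqrt (n * ln n))\<^sup>2 / (2 * n)) = exp (- 2 * ln n)"
    using n(2) by (simp add: power_mult_distrib)
  also have "\<dots> = 1 / n\<^sup>2"
    using n(2) by (simp add: exp_minus exp_double inverse_eq_divide)
  finally have e: "exp (- (2 * sqrt (n * ln n))\<^sup>2 / (2 * n)) = 1 / n\<^sup>2" .
  have "real (card (nodes M)) \<le> n / 2"
    using of_nat_mono[OF card_nodes[of M], where 'a = real] by (simp add: n(1))
  then have "2 * real (card (nodes M)) * (1 / n\<^sup>2) \<le> n * (1 / n\<^sup>2)"
    by (intro mult_right_mono) auto
  also have "\<dots> = 1 / n" using n(2) by (simp add: power2_eq_square)
  also have "\<dots> \<le> 4 / n" using n(2) by (simp add: divide_right_mono)
  finally have "1 - 4 / n \<le> 1 - 2 * real (card (nodes M)) * exp (- (2 * sqrt (n * ln n))\<^sup>2 / (2 * n))"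
    unfolding e by linarith
  also have "\<dots> \<le> measure (Pi\<^sub>M {1..sample_size M} (\<lambda>_. std_normal))
      {eps \<in> space (Pi\<^sub>M {1..sample_size M} (\<lambda>_. std_normal)).
        \<forall>v\<in>nodes M. \<bar>\<Sum>i\<in>{1..sample_size M}. design_matrix M i v * eps i\<bar> < 2 * sqrt (n * ln n)}"
  proof (rule normal_linear_forms_bounded)
    fix v assume "v \<in> nodes M"
    then show "(\<Sum>i\<in>{1..sample_size M}. (design_matrix M i v)\<^sup>2) = n"
      unfolding power2_eq_square by (subst design_orthogonal) (simp_all add: n_def)
  qed (use n in \<open>auto simp: finite_nodes\<close>)
  finally show ?thesis unfolding score_def .
qed

section \<open>Consistency of the posterior\<close>

theorem theorem1:
  fixes c :: real
  assumes "c > 5 / 2"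
  shows "\<exists>A0>0. \<forall>A\<ge>A0. \<forall>C>0. \<forall>(Lmax::nat) (L::nat) (n::nat) B \<beta> f0.
    n = sample_size Lmax \<longrightarrow> L \<le> Lmax \<longrightarrow>
    assumption_Fa n L A C B \<beta> f0 \<or> assumption_Fb n L A C B \<beta> f0 \<longrightarrow>
    measure (data_law n f0)
      {y \<in> space (data_law n f0).
         tree_posterior Lmax L (\<lambda>_. real n powr (- c)) y (smallest_tree L B)
           \<ge> 1 - 1 / (real n powr (c - 5 / 2) - 1) - 1 / real n powr (A\<^sup>2 / 8 * ln (real n))}
    \<ge> 1 - 4 / real n"
\<comment> \<open>The constant makes \<open>A\<^sup>2 / 8 \<ge> 3/2 * (c + 3) + 1\<close>, as used in \<open>missing_nodes_exponent\<close>, and \<open>A \<ge> 8\<close>.\<close>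
proof (intro exI[of _ "12 * c + 44"] conjI allI impI)
  show "0 < 12 * c + 44" using assms by simp
next
  fix A C :: real and Lmax L n :: nat and B \<beta> and f0 :: "real \<Rightarrow> real"
  assume A: "12 * c + 44 \<le> A" and n: "n = sample_size Lmax" and L: "L \<le> Lmax"
    and F: "assumption_Fa n L A C B \<beta> f0 \<or> assumption_Fb n L A C B \<beta> f0"
  define bound where
    "bound = 1 - 1 / (real n powr (c - 5 / 2) - 1) - 1 / real n powr (A\<^sup>2 / 8 * ln (real n))"
  define post where "post y = tree_posterior Lmax L (\<lambda>_. real n powr (- c)) y (smallest_tree L B)" for y
  let ?S = "{y \<in> space (data_law n f0). bound \<le> post y}"
  have "1 - 4 / real n \<le> measure (data_law n f0) ?S"
  proof (cases "Lmax \<le> 1")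
    case True
    then have "real n \<le> 4" using power_increasing[of "Lmax + 1" 2 "2::real"]
      by (simp add: n sample_size_def)
    moreover have "0 < real n" by (simp add: n sample_size_def)
    ultimately have "1 - 4 / real n \<le> 0" by (simp add: field_simps)
    then show ?thesis using measure_nonneg by (rule order_trans)
  next
    case False
    \<comment> \<open>From here on \<open>n \<ge> 8\<close>; for \<open>n \<le> 4\<close> the claimed probability \<open>1 - 4 / n\<close> is not positive.\<close>
    have n1: "1 < real n" by (simp add: n sample_size_def one_less_power del: power_Suc)
    have B: "B \<subseteq> nodes L" and f0: "\<And>x. x \<in> {0..1} \<Longrightarrow> f0 x = (\<Sum>v\<in>B. \<beta> v * haar v x)"
      and \<beta>: "\<And>v. v \<in> B \<Longrightarrow> A * ln (real n) / sqrt (real n) < \<bar>\<beta> v\<bar>"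
      using F by (auto simp: assumption_Fa_def assumption_Fb_def assumption_F_def)
    let ?I = "{1..n}"
    let ?P = "Pi\<^sub>M ?I (\<lambda>_. std_normal)" and ?Y = "Pi\<^sub>M ?I (\<lambda>_. borel :: real measure)"
    define data where "data = (\<lambda>eps :: nat \<Rightarrow> real. \<lambda>i\<in>?I. f0 (design_point n i) + eps i)"
    have data: "data \<in> measurable ?P ?Y" unfolding data_def by measurable
    have law: "data_law n f0 = distr ?P ?Y data" by (simp only: data_law_def data_def)
    have q: "0 < real n powr (- c)" "real n powr (- c) < 1"
      using n1 assms powr_less_mono[of "- c" 0 "real n"] by auto
    \<comment> \<open>The event has to be measurable to have a probability; the closed form of the posterior
      shows that it is.\<close>
    have "post \<in> borel_measurable ?Y"
      unfolding post_def using borel_measurable_tree_posterior[OF L q smallest_tree(1)[OF B]]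
      by (simp add: n)
    then have S: "?S \<in> sets ?Y" unfolding law space_distr by measurable
    have score: "score Lmax (data eps) v - real n * (if v \<in> B then \<beta> v else 0) = score Lmax eps v"
      if v: "v \<in> nodes Lmax" for eps v
    proof -
      have "score Lmax (data eps) v = score Lmax (\<lambda>i. f0 (design_point n i) + eps i) v"
        unfolding score_def data_def n by (intro sum.cong refl) simp
      also have "\<dots> = real n * (if v \<in> B then \<beta> v else 0) + score Lmax eps v"
        unfolding n using B nodes_mono[OF L] v f0 by (intro score_signal) auto
      finally show ?thesis by simp
    qed
    have bound: "bound \<le> 1 - real n powr (5 / 2 - c) / 2 - exp (- (A\<^sup>2 / 8 * (ln (real n))\<^sup>2))"
    proof -
      \<comment> \<open>The term \<open>1 / (z - 1)\<close> of the claim is weaker than the \<open>1 / (2 z)\<close> obtained.\<close>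
      define z where "z = real n powr (c - 5 / 2)"
      have z: "1 < z" unfolding z_def using n1 assms powr_less_mono[of 0 "c - 5 / 2" "real n"] by simp
      have "real n powr (5 / 2 - c) / 2 = 1 / (2 * z)"
        unfolding z_def using powr_minus[of "real n" "c - 5 / 2"] by (simp add: inverse_eq_divide)
      also have "\<dots> \<le> 1 / (z - 1)" using z by (intro divide_left_mono) auto
      finally have "real n powr (5 / 2 - c) / 2 \<le> 1 / (z - 1)" .
      moreover have "1 / real n powr (A\<^sup>2 / 8 * ln (real n)) = exp (- (A\<^sup>2 / 8 * (ln (real n))\<^sup>2))"
        using n1 by (simp add: powr_def exp_minus inverse_eq_divide power2_eq_square mult_ac)
      ultimately show ?thesis unfolding bound_def z_def by simp
    qed
    let ?G = "{eps \<in> space ?P. \<forall>v\<in>nodes Lmax. \<bar>score Lmax eps v\<bar> < 2 * sqrt (real n * ln (real n))}"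
    have good: "?G \<subseteq> data -` ?S \<inter> space ?P"
    proof
      fix eps assume eps: "eps \<in> ?G"
      have "1 - real n powr (5 / 2 - c) / 2 - exp (- (A\<^sup>2 / 8 * (ln (real n))\<^sup>2)) \<le> post (data eps)"
        unfolding post_def n
      proof (rule tree_posterior_ge)
        fix v assume v: "v \<in> nodes Lmax"
        show "\<bar>score Lmax (data eps) v - real (sample_size Lmax) * (if v \<in> B then \<beta> v else 0)\<bar> <
            2 * sqrt (real (sample_size Lmax) * ln (real (sample_size Lmax)))"
          using eps v unfolding n[symmetric] score[OF v] by blast
      qed (use False L assms A B \<beta> in \<open>auto simp: n\<close>)
      then have "bound \<le> post (data eps)" using bound by linarith
      then show "eps \<in> data -` ?S \<inter> space ?P"
        using eps measurable_space[OF data] by (auto simp: law)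
    qed
    have "1 - 4 / real n \<le> measure ?P ?G" using noise_bounded[of Lmax] by (simp add: n)
    also have "\<dots> \<le> measure ?P (data -` ?S \<inter> space ?P)"
      using good measurable_sets[OF data S]
      by (intro finite_measure.finite_measure_mono prob_space.finite_measure prob_space_PiM
          prob_space_std_normal)
    also have "\<dots> = measure (data_law n f0) ?S"
      unfolding law using measure_distr[OF data] S by (simp add: law)
    finally show ?thesis .
  qed
  then show "1 - 4 / real n \<le> measure (data_law n f0)
      {y \<in> space (data_law n f0).
         tree_posterior Lmax L (\<lambda>_. real n powr (- c)) y (smallest_tree L B)
           \<ge> 1 - 1 / (real n powr (c - 5 / 2) - 1) - 1 / real n powr (A\<^sup>2 / 8 * ln (real n))}"
    unfolding bound_def post_def .
qed

end
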